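(* Assume that $\mathfrak{c}=2^{\aleph_0}$ is a regular cardinal and let $t_0\in\{s_0,m_0,l_0,cl_0\}$. Then for every generalized Luzin set $L\subseteq\mathbb{R}$ and every generalized Sierpiński set $S\subseteq\mathbb{R}$, the algebraic sum $L+S=\{x+y: x\in L, y\in S\}$ belongs to $t_0$.
   Context: A set $L\subseteq\mathbb{R}$ is a generalized Luzin set if $|A\cap L|<|L|$ for every meager $A\subseteq\mathbb{R}$. A set $S\subseteq\mathbb{R}$ is a generalized Sierpiński set if $|A\cap S|<|S|$ for every Lebesgue null $A\subseteq\mathbb{R}$. A tree on $\omega$ is a nonempty set $T\subseteq\omega^{<\omega}$ closed under initial segments; $[T]=\{x\in\omega^\omega:(\forall n)\ x\restriction n\in T\}$ is its body; for $t\in T$, $succ(t)=\{a\in\omega: t^\frown a\in T\}$; $stem(T)$ is the node $\tau\in T$ such that $|succ(\tau)|>1$ and $|succ(s)|=1$ for each $s\subsetneq\tau$. $T$ is a Sacks (perfect) tree, $T\in\mathbb{S}$, if every $s\in T$ has an extension $t\in T$, $s\subseteq t$, with $|succ(t)|\ge 2$; a Miller tree, $T\in\mathbb{M}$, if every $s\in T$ has an extension $t\in T$, $s\subseteq t$, with $|succ(t)|=\aleph_0$; a Laver tree, $T\in\mathbb{L}$, if $|succ(t)|=\aleph_0$ for every $t\in T$ with $t\supseteq stem(T)$; a complete Laver tree, $T\in\mathbb{CL}$, if $T$ is a Laver tree with $stem(T)=\emptyset$. For a family of trees $\mathbb{T}$, a set $A\subseteq\omega^\omega$ belongs to $t_0$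 (in $\omega^\omega$) if for every $P\in\mathbb{T}$ there is $Q\in\mathbb{T}$ with $Q\subseteq P$ and $[Q]\cap A=\emptyset$; $s_0,m_0,l_0,cl_0$ correspond to $\mathbb{T}=\mathbb{S},\mathbb{M},\mathbb{L},\mathbb{CL}$. Convention on $\mathbb{R}$: fix a homeomorphism $h$ from $\omega^\omega$ onto the subspace $\mathbb{R}\setminus\mathbb{Q}$ of irrational numbers such that, for every nonempty $\tau\in\omega^{<\omega}$, the image under $h$ of $\{x\in\omega^\omega:\tau\subseteq x\}$ is the set of irrational points of an open interval with rational endpoints. A set $A\subseteq\mathbb{R}$ is said to belong to $t_0$ if $h^{-1}[A]$ belongs to $t_0$ in $\omega^\omega$. *)

theory Defs
  imports "HOL-Analysis.Analysis" "HOL-Library.Sublist" "HOL-Library.Equipollence"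
begin

definition nowhere_dense :: "'a::topological_space set \<Rightarrow> bool" where
  "nowhere_dense A \<longleftrightarrow> interior (closure A) = {}"

definition meager :: "'a::topological_space set \<Rightarrow> bool" where
  "meager A \<longleftrightarrow> (\<exists>\<N>. countable \<N> \<and> (\<forall>N\<in>\<N>. nowhere_dense N) \<and> A = \<Union>\<N>)"

definition generalized_Luzin :: "real set \<Rightarrow> bool" where
  "generalized_Luzin L \<longleftrightarrow> (\<forall>A. meager A \<longrightarrow> A \<inter> L \<prec> L)"

(* null_sets lebesgue refers to the completed measure, so it contains all subsets
   of Borel null sets. *)
definition generalized_Sierpinski :: "real set \<Rightarrow> bool" where
  "generalized_Sierpinski S \<longleftrightarrow> (\<forall>A. A \<in> null_sets lebesgue \<longrightarrow> A \<inter> S \<prec> S)"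

definition is_tree :: "nat list set \<Rightarrow> bool" where
  "is_tree T \<longleftrightarrow> T \<noteq> {} \<and> (\<forall>t\<in>T. \<forall>s. prefix s t \<longrightarrow> s \<in> T)"

definition restr :: "(nat \<Rightarrow> nat) \<Rightarrow> nat \<Rightarrow> nat list" where
  "restr x n = map x [0..<n]"

definition body :: "nat list set \<Rightarrow> (nat \<Rightarrow> nat) set" where
  "body T = {x. \<forall>n. restr x n \<in> T}"

definition cylinder :: "nat list \<Rightarrow> (nat \<Rightarrow> nat) set" where
  "cylinder \<tau> = {x. restr x (length \<tau>) = \<tau>}"

definition succs :: "nat list set \<Rightarrow> nat list \<Rightarrow> nat set" where
  "succs T t = {a. t @ [a] \<in> T}"

(* At least two successors; card is avoided because it is 0 on infinite sets. *)
definition splitting :: "nat list set \<Rightarrow> nat list \<Rightarrow> bool" where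
  "splitting T t \<longleftrightarrow> (\<exists>a\<in>succs T t. \<exists>b\<in>succs T t. a \<noteq> b)"

(* A tree has at most one stem, but it need not have any (e.g. a single branch);
   hence a relation rather than a function. *)
definition is_stem :: "nat list set \<Rightarrow> nat list \<Rightarrow> bool" where
  "is_stem T \<tau> \<longleftrightarrow> \<tau> \<in> T \<and> splitting T \<tau> \<and> (\<forall>s. strict_prefix s \<tau> \<longrightarrow> is_singleton (succs T s))"

definition sacks_trees :: "nat list set set" where
  "sacks_trees = {T. is_tree T \<and> (\<forall>s\<in>T. \<exists>t\<in>T. prefix s t \<and> splitting T t)}"

definition miller_trees :: "nat list set set" where
  "miller_trees = {T. is_tree T \<and> (\<forall>s\<in>T. \<exists>t\<in>T. prefix s t \<and> infinite (succs T t))}"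

definition laver_trees :: "nat list set set" where
  "laver_trees = {T. is_tree T \<and>
     (\<exists>\<tau>. is_stem T \<tau> \<and> (\<forall>t\<in>T. prefix \<tau> t \<longrightarrow> infinite (succs T t)))}"

definition complete_laver_trees :: "nat list set set" where
  "complete_laver_trees = {T \<in> laver_trees. is_stem T []}"

definition tree_ideal :: "nat list set set \<Rightarrow> (nat \<Rightarrow> nat) set set" where
  "tree_ideal \<T> = {A. \<forall>P\<in>\<T>. \<exists>Q\<in>\<T>. Q \<subseteq> P \<and> body Q \<inter> A = {}}"

definition s0 :: "(nat \<Rightarrow> nat) set set" where "s0 = tree_ideal sacks_trees"
definition m0 :: "(nat \<Rightarrow> nat) set set" where "m0 = tree_ideal miller_trees"
definition l0 :: "(nat \<Rightarrow> nat) set set" where "l0 = tree_ideal laver_trees"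
definition cl0 :: "(nat \<Rightarrow> nat) set set" where "cl0 = tree_ideal complete_laver_trees"

(* The topology on nat => nat is the product topology, with nat discrete. *)
definition irrational_coding :: "((nat \<Rightarrow> nat) \<Rightarrow> real) \<Rightarrow> bool" where
  "irrational_coding h \<longleftrightarrow>
     homeomorphic_map euclidean (top_of_set (- \<rat>)) h \<and>
     (\<forall>\<tau>. \<tau> \<noteq> [] \<longrightarrow> (\<exists>a\<in>\<rat>. \<exists>b\<in>\<rat>. h ` cylinder \<tau> = {a<..<b} - \<rat>))"

definition in_ideal_via :: "((nat \<Rightarrow> nat) \<Rightarrow> real) \<Rightarrow> (nat \<Rightarrow> nat) set set \<Rightarrow> real set \<Rightarrow> bool" where
  "in_ideal_via h I A \<longleftrightarrow> h -` A \<in> I"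

end

theory Submission
  imports Defs
begin

text \<open>
  The four families of trees have one property in common: every tree in the family has subtrees
  in the family, indexed by all functions \<open>nat \<Rightarrow> bool\<close>, whose bodies are pairwise disjoint.
  The property is called \<open>splits_disjointly\<close>, and the whole argument rests on using it twice.

  The first use makes a tree null. The bodies of the subtrees are closed, so \<open>h\<close> maps
  them to uncountably many pairwise disjoint Borel sets of reals. One of these images is Lebesgue
  null. Its closure \<open>E\<close> adds only rational points, because \<open>h\<close> is a homeomorphism onto the
  irrationals. Hence below every tree of the family there is one whose body is mapped into a
  closed null set \<open>E\<close>.

  The heart of the proof is that \<open>L + S\<close> meets a closed null set \<open>E\<close> in fewer than continuum many
  points. There is a meager set \<open>M\<close> such that the set \<open>N\<close> of all differences \<open>z - x\<close>
  with \<open>z \<in> E\<close> and \<open>x \<notin> M\<close> is null (\<open>closed_null_minus_comeager_null\<close>). If \<open>x \<in> L\<close>, \<open>y \<in> S\<close>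
  and \<open>x + y \<in> E\<close>, then \<open>x \<in> L \<inter> M\<close> or \<open>y \<in> S \<inter> N\<close>. Both intersections have size less than the
  continuum. A fixed \<open>x\<close> leaves fewer than continuum many \<open>y \<in> S\<close> with \<open>x + y \<in> E\<close>, since \<open>E - x\<close>
  is null. A fixed \<open>y\<close> leaves fewer than continuum many \<open>x \<in> L\<close>, since \<open>E - y\<close> is closed and
  null and therefore meager. So the intersection is covered by fewer than continuum many sets of size less
  than the continuum, and regularity of the continuum bounds the union.

  The second use of disjoint splitting finishes the proof. The null tree has continuum many
  subtrees with disjoint bodies. They cannot all meet the preimage of \<open>L + S\<close>,
  because different subtrees would contribute different points of \<open>(L + S) \<inter> E\<close>.
\<close>


section \<open>Sequences and cylinders\<close>

lemma restr_take: "m \<le> n \<Longrightarrow> take m (restr x n) = restr x m"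
  unfolding restr_def by (simp add: take_map take_upt)

lemma length_restr [simp]: "length (restr x n) = n"
  by (simp add: restr_def)

lemma restr_in_cylinder: "x \<in> cylinder (restr x n)"
  by (simp add: cylinder_def)

lemma cylinder_prefix:
  assumes "x \<in> cylinder u" "prefix t u"
  shows "x \<in> cylinder t"
proof -
  obtain v where v: "u = t @ v" using assms(2) by (auto simp: prefix_def)
  have "restr x (length t) = take (length t) u"
    using assms(1) restr_take[of "length t" "length u" x] v by (simp add: cylinder_def)
  then show ?thesis using v by (simp add: cylinder_def)
qed

lemma cylinder_comparable:
  assumes "x \<in> cylinder t" "x \<in> cylinder u" "length t \<le> length u"
  shows "prefix t u"
proof -
  have "take (length t) u = t"
    using restr_take[OF assms(3), of x] assms(1,2) by (simp add: cylinder_def)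
  then show ?thesis
    using take_is_prefix[of "length t" u] by simp
qed

lemma cylinder_snoc: "x \<in> cylinder (t @ [a]) \<longleftrightarrow> x \<in> cylinder t \<and> x (length t) = a"
  unfolding cylinder_def by (auto simp: restr_def)

lemma cylinder_Nil [simp]: "cylinder [] = UNIV"
  by (simp add: cylinder_def restr_def)

lemma cylinder_nonempty: "\<exists>x. x \<in> cylinder t"
proof
  show "(\<lambda>i. t ! i) \<in> cylinder t"
    unfolding cylinder_def restr_def by (simp add: map_nth)
qed

lemma open_cylinder: "open (cylinder t)"
proof (induction t rule: rev_induct)
  case (snoc a t)
  have "cylinder (t @ [a]) = cylinder t \<inter> (\<lambda>x. x (length t)) -` {a}"
    by (auto simp: cylinder_snoc)
  moreover have "open ((\<lambda>x::nat \<Rightarrow> nat. x (length t)) -` {a})"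
    by (intro open_vimage continuous_on_product_coordinates open_discrete)
  ultimately show ?case
    using snoc by (simp add: open_Int)
qed simp

lemma closed_body: "closed (body T)"
proof -
  have "- body T = (\<Union>t \<in> - T. cylinder t)"
  proof safe
    fix x assume "x \<notin> body T"
    then obtain n where "restr x n \<notin> T" unfolding body_def by blast
    then show "x \<in> (\<Union>t \<in> - T. cylinder t)"
      using restr_in_cylinder by blast
  next
    fix x t assume "x \<in> body T" and t: "t \<notin> T" "x \<in> cylinder t"
    then have "restr x (length t) \<in> T"
      by (simp add: body_def)
    then show False
      using t by (simp add: cylinder_def)
  qed
  moreover have "open (\<Union>t \<in> - T. cylinder t)"
    using open_cylinder by blast
  ultimately show ?thesis
    by (simp add: closed_def)
qed

lemma body_mono: "Q \<subseteq> P \<Longrightarrow> body Q \<subseteq> body P"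
  unfolding body_def by blast

section \<open>Growing subtrees\<close>

text \<open>
  A node \<open>t\<close> grown at level \<open>k\<close> is followed by each node \<open>e (t @ [a])\<close> with \<open>a \<in> A t k\<close>.
  Here \<open>e\<close> prolongs a node until it reaches one with enough successors in a given tree,
  and \<open>A t k\<close> selects some of these successors. The level counts the selections made
  so far. It has to be kept separately from the length of the node, because \<open>e\<close> can add any
  number of entries.
\<close>

inductive grown :: "(nat list \<Rightarrow> nat list) \<Rightarrow> (nat list \<Rightarrow> nat \<Rightarrow> nat set) \<Rightarrow> nat list \<Rightarrow> nat \<Rightarrow> bool"
  for e A where
  root: "grown e A (e []) 0"
| step: "grown e A t k \<Longrightarrow> a \<in> A t k \<Longrightarrow> grown e A (e (t @ [a])) (Suc k)"

definition grown_tree :: "(nat list \<Rightarrow> nat list) \<Rightarrow> (nat list \<Rightarrow> nat \<Rightarrow> nat set) \<Rightarrow> nat list set" where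
  "grown_tree e A = {s. \<exists>t k. grown e A t k \<and> prefix s t}"

lemma is_tree_grown_tree: "is_tree (grown_tree e A)"
  unfolding is_tree_def grown_tree_def using grown.root prefix_order.trans by blast

lemma grown_tree_subset:
  assumes "is_tree P" "\<And>t k. grown e A t k \<Longrightarrow> t \<in> P"
  shows "grown_tree e A \<subseteq> P"
  using assms unfolding grown_tree_def is_tree_def by blast

text \<open>
  Grown trees with the same \<open>e\<close> are compared along a common branch. The branch alone determines
  the grown node at each level, whatever the selections are: the next node is \<open>e (t @ [a])\<close>
  where \<open>a\<close> is the entry that the branch has after \<open>t\<close>. Hence selections that
  are disjoint at every node of one level give disjoint bodies.
\<close>

locale node_extension =
  fixes e :: "nat list \<Rightarrow> nat list"
  assumes extends: "prefix s (e s)"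
begin

lemma choices_subset_succs: "grown e A t k \<Longrightarrow> A t k \<subseteq> succs (grown_tree e A) t"
  unfolding succs_def grown_tree_def using grown.step extends by blast

lemma root_prefix_grown: "grown e A t k \<Longrightarrow> prefix (e []) t"
proof (induction rule: grown.induct)
  case (step t k a)
  then show ?case
    using extends[of "t @ [a]"] by (metis prefixI prefix_order.trans)
qed simp

lemma grown_ancestor:
  assumes "grown e A u j" "k \<le> j"
  shows "\<exists>t. grown e A t k \<and> prefix t u \<and> (k < j \<longrightarrow> (\<exists>a\<in>A t k. prefix (e (t @ [a])) u))"
  using assms
proof (induction arbitrary: k rule: grown.induct)
  case root
  then show ?case using grown.root by auto
next
  case (step t j a)
  have t: "prefix t (e (t @ [a]))"
    using extends[of "t @ [a]"] by (metis prefixI prefix_order.trans)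
  consider "k = Suc j" | "k = j" | "k < j" using step.prems by linarith
  then show ?case
  proof cases
    case 1
    then show ?thesis using grown.step[OF step.hyps] by auto
  next
    case 2
    then show ?thesis using step.hyps t by auto
  next
    case 3
    then show ?thesis
      using step.IH[of k] t step.prems by (meson less_imp_le prefix_order.trans)
  qed
qed

lemma grown_level_unique:
  assumes "grown e A t k" "grown e B t' k" "x \<in> cylinder t" "x \<in> cylinder t'"
  shows "t = t'"
  using assms
proof (induction k arbitrary: t t' rule: nat_induct)
  case 0
  then show ?case by (auto elim!: grown.cases)
next
  case (Suc k)
  from Suc.prems(1) obtain s a where s: "grown e A s k" "a \<in> A s k" "t = e (s @ [a])"
    by (auto elim: grown.cases)
  from Suc.prems(2) obtain s' a' where s': "grown e B s' k" "a' \<in> B s' k" "t' = e (s' @ [a'])"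
    by (auto elim: grown.cases)
  have x: "x \<in> cylinder (s @ [a])" "x \<in> cylinder (s' @ [a'])"
    using Suc.prems(3,4) s(3) s'(3) extends cylinder_prefix by blast+
  then have "s = s'"
    using Suc.IH s(1) s'(1) cylinder_snoc by blast
  then show ?case
    using x s(3) s'(3) by (simp add: cylinder_snoc)
qed

text \<open>
  A long initial segment of \<open>x\<close> lies below some grown node \<open>u\<close>. The level of \<open>u\<close> exceeds \<open>k\<close>,
  for otherwise uniqueness of levels would make \<open>u\<close> an initial segment of \<open>t\<close>. Therefore \<open>u\<close> passes through
  a successor of \<open>t\<close>, and the entry of \<open>x\<close> after \<open>t\<close> tells which.
\<close>

lemma branch_step:
  assumes x: "x \<in> body (grown_tree e A)" and t: "grown e A t k" "x \<in> cylinder t"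
  shows "x (length t) \<in> A t k \<and> x \<in> cylinder (e (t @ [x (length t)]))"
proof -
  let ?a = "x (length t)" and ?v = "e (t @ [x (length t)])"
  have len: "length t < length ?v"
    using extends[of "t @ [?a]"] prefix_length_le by force
  have "restr x (length ?v) \<in> grown_tree e A"
    using x unfolding body_def by blast
  then obtain u j where u: "grown e A u j" "prefix (restr x (length ?v)) u"
    unfolding grown_tree_def by blast
  \<comment> \<open>A branch through \<open>u\<close> is needed to apply uniqueness of levels; \<open>x\<close> itself may leave \<open>u\<close>.\<close>
  obtain y where y: "y \<in> cylinder u"
    using cylinder_nonempty by blast
  have "x \<in> cylinder (t @ [?a])"
    using t(2) by (simp add: cylinder_snoc)
  then have "prefix (t @ [?a]) (restr x (length ?v))"
    using len cylinder_comparable[OF _ restr_in_cylinder] by simp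
  then have ta: "prefix (t @ [?a]) u"
    using u(2) by (rule prefix_order.trans)
  then have yta: "y \<in> cylinder (t @ [?a])"
    using y cylinder_prefix by blast
  then have yt: "y \<in> cylinder t"
    by (simp add: cylinder_snoc)
  have "k < j"
  proof (rule ccontr)
    assume "\<not> k < j"
    then obtain t0 where "grown e A t0 j" "prefix t0 t"
      using grown_ancestor[OF t(1), of j] by auto
    then have "u = t0"
      using grown_level_unique[OF u(1) _ y] cylinder_prefix[OF yt] by blast
    then show False
      using prefix_length_le[OF ta] prefix_length_le[OF \<open>prefix t0 t\<close>] by simp
  qed
  then obtain t' a where t': "grown e A t' k" "prefix t' u" "a \<in> A t' k" "prefix (e (t' @ [a])) u"
    using grown_ancestor[OF u(1), of k] by auto
  have "t' = t"
    using grown_level_unique[OF t'(1) t(1) _ yt] cylinder_prefix[OF y t'(2)] by blast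
  moreover have "y \<in> cylinder (t' @ [a])"
    using t'(4) y extends cylinder_prefix by blast
  ultimately have a: "t' = t" "a = ?a"
    using yta by (auto simp: cylinder_snoc)
  then have "prefix ?v u" using t'(4) by simp
  then have "?v = restr x (length ?v)"
    using u(2) by (metis length_restr prefix_same_cases prefix_length_prefix le_refl prefix_order.antisym)
  then show ?thesis
    using t'(3) a restr_in_cylinder by metis
qed

lemma branch_levels:
  assumes "x \<in> body (grown_tree e A)"
  shows "\<exists>t. grown e A t k \<and> x \<in> cylinder t"
proof (induction k)
  case 0
  obtain u j where u: "grown e A u j" "prefix (restr x (length (e []))) u"
    using assms unfolding body_def grown_tree_def by blast
  have "prefix (e []) u"
    using u(1) root_prefix_grown by blast
  then have "e [] = restr x (length (e []))"
    using u(2) by (metis length_restr prefix_length_prefix le_refl prefix_order.antisym)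
  then show ?case
    using grown.root restr_in_cylinder by metis
next
  case (Suc k)
  then show ?case
    using branch_step[OF assms] grown.step by blast
qed

lemma common_branch_choices_meet:
  assumes "x \<in> body (grown_tree e A)" "x \<in> body (grown_tree e B)"
  shows "\<exists>t. A t k \<inter> B t k \<noteq> {}"
proof -
  obtain t where t: "grown e A t k" "x \<in> cylinder t"
    using branch_levels assms(1) by blast
  obtain t' where t': "grown e B t' k" "x \<in> cylinder t'"
    using branch_levels assms(2) by blast
  have "t = t'"
    using grown_level_unique t t' by blast
  then show ?thesis
    using branch_step[OF assms(1) t] branch_step[OF assms(2) t'] by blast
qed

end

section \<open>Splitting a tree into continuum many\<close>

text \<open>
  The set \<open>C t\<close> divides the successors of \<open>t\<close> into two classes. At the even level \<open>2 * i\<close> the value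
  \<open>f i\<close> decides which class survives, so that a branch of the grown tree determines \<open>f\<close>.
  At odd levels every successor survives. A perfect tree needs these levels, because a class can
  consist of a single successor and then there is no splitting at even levels.
\<close>

definition coded_choices :: "nat list set \<Rightarrow> (nat list \<Rightarrow> nat set) \<Rightarrow> (nat \<Rightarrow> bool) \<Rightarrow> nat list \<Rightarrow> nat \<Rightarrow> nat set" where
  "coded_choices P C f t k = {a \<in> succs P t. even k \<longrightarrow> (a \<in> C t \<longleftrightarrow> f (k div 2))}"

lemma (in node_extension) coded_bodies_disjoint:
  assumes "f \<noteq> g"
  shows "body (grown_tree e (coded_choices P C f)) \<inter> body (grown_tree e (coded_choices P C g)) = {}"
proof (rule ccontr)
  assume "\<not> ?thesis"
  then obtain x where x: "x \<in> body (grown_tree e (coded_choices P C f))" "x \<in> body (grown_tree e (coded_choices P C g))"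
    by blast
  have "f i = g i" for i
    using common_branch_choices_meet[OF x, of "2 * i"] by (auto simp: coded_choices_def)
  then show False using assms by blast
qed

definition splits_disjointly :: "nat list set set \<Rightarrow> bool" where
  "splits_disjointly \<T> \<longleftrightarrow> (\<forall>P\<in>\<T>. \<exists>Q :: (nat \<Rightarrow> bool) \<Rightarrow> nat list set.
     (\<forall>f. Q f \<in> \<T> \<and> Q f \<subseteq> P) \<and> (\<forall>f g. f \<noteq> g \<longrightarrow> body (Q f) \<inter> body (Q g) = {}))"

lemma grown_coded_good:
  assumes "e [] \<in> G" "\<And>t a. t \<in> G \<Longrightarrow> a \<in> succs P t \<Longrightarrow> e (t @ [a]) \<in> G"
    and "grown e (coded_choices P C f) t k"
  shows "t \<in> G"
  using assms(3) by induction (auto simp: assms(1,2) coded_choices_def)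

lemma good_extension:
  assumes "is_tree P" "\<forall>s\<in>P. \<exists>t\<in>P. prefix s t \<and> good t"
  obtains e where "node_extension e" "\<And>s. s \<in> P \<Longrightarrow> e s \<in> P \<and> good (e s)"
proof -
  have "\<forall>s. \<exists>t. prefix s t \<and> (s \<in> P \<longrightarrow> t \<in> P \<and> good t)"
    using assms(2) by blast
  then obtain e where e: "\<And>s. prefix s (e s) \<and> (s \<in> P \<longrightarrow> e s \<in> P \<and> good (e s))"
    by metis
  show thesis
    by (rule that[of e]) (use e in \<open>auto simp: node_extension_def\<close>)
qed

lemma infinite_halving:
  obtains C :: "nat list \<Rightarrow> nat set"
  where "\<And>t. infinite (succs P t) \<Longrightarrow> infinite (succs P t \<inter> C t) \<and> infinite (succs P t - C t)"
proof -
  have "\<exists>C. infinite X \<longrightarrow> infinite (X \<inter> C) \<and> infinite (X - C)" for X :: "nat set"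
  proof (cases "infinite X")
    case True
    then obtain C D where "C \<subseteq> X" "D \<subseteq> X" "infinite C" "infinite D" "C \<inter> D = {}"
      using infinite_split by blast
    moreover from this have "X \<inter> C = C" "D \<subseteq> X - C" by auto
    ultimately have "infinite (X \<inter> C) \<and> infinite (X - C)"
      using finite_subset[of D "X - C"] by auto
    then show ?thesis by blast
  qed blast
  then have "\<forall>t. \<exists>C. infinite (succs P t) \<longrightarrow> infinite (succs P t \<inter> C) \<and> infinite (succs P t - C)"
    by blast
  from choice[OF this] show thesis
    using that by blast
qed

lemma infinite_coded_choices:
  assumes "infinite (succs P t \<inter> C t)" "infinite (succs P t - C t)"
  shows "infinite (coded_choices P C f t k)"
proof (cases "even k \<longrightarrow> f (k div 2)")
  case True
  then have "succs P t \<inter> C t \<subseteq> coded_choices P C f t k"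
    by (auto simp: coded_choices_def)
  then show ?thesis using assms(1) finite_subset by blast
next
  case False
  then have "succs P t - C t \<subseteq> coded_choices P C f t k"
    by (auto simp: coded_choices_def)
  then show ?thesis using assms(2) finite_subset by blast
qed

lemma is_tree_Nil: "is_tree P \<Longrightarrow> [] \<in> P"
  unfolding is_tree_def by auto

text \<open>
  Each splitting node has two nonempty classes of successors. Even levels may stop splitting,
  but every node of the new tree extends to a grown node of odd level, which retains
  all its successors.
\<close>

lemma sacks_splits_disjointly: "splits_disjointly sacks_trees"
  unfolding splits_disjointly_def
proof
  fix P assume "P \<in> sacks_trees"
  then have P: "is_tree P" and ext: "\<forall>s\<in>P. \<exists>t\<in>P. prefix s t \<and> splitting P t"
    unfolding sacks_trees_def by auto
  obtain e where "node_extension e" and e: "\<And>s. s \<in> P \<Longrightarrow> e s \<in> P \<and> splitting P (e s)"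
    using good_extension[OF P ext] by blast
  interpret node_extension e by fact
  have "\<exists>C. splitting P t \<longrightarrow> succs P t \<inter> C \<noteq> {} \<and> succs P t - C \<noteq> {}" for t
  proof (cases "splitting P t")
    case True
    then obtain a b where "a \<in> succs P t" "b \<in> succs P t" "a \<noteq> b"
      unfolding splitting_def by blast
    then show ?thesis by (intro exI[of _ "{a}"]) auto
  qed blast
  then obtain C where C: "\<And>t. splitting P t \<Longrightarrow> succs P t \<inter> C t \<noteq> {} \<and> succs P t - C t \<noteq> {}"
    by metis
  define Q where "Q f = grown_tree e (coded_choices P C f)" for f
  have good: "t \<in> P \<and> splitting P t" if "grown e (coded_choices P C f) t k" for f t k
    using grown_coded_good[of e "{t \<in> P. splitting P t}" P C f t k] that e is_tree_Nil[OF P]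
    by (auto simp: succs_def)
  have sub: "Q f \<subseteq> P" for f
    unfolding Q_def using grown_tree_subset[OF P] good by blast
  have "\<exists>t\<in>Q f. prefix s t \<and> splitting (Q f) t" if s: "s \<in> Q f" for s f
  proof -
    let ?A = "coded_choices P C f"
    obtain t k where t: "grown e ?A t k" "prefix s t"
      using s unfolding Q_def grown_tree_def by blast
    obtain t' k' where t': "grown e ?A t' k'" "prefix s t'" "odd k'"
    proof (cases "odd k")
      case True
      then show thesis using t that by blast
    next
      case False
      obtain a where "a \<in> ?A t k"
        using C[of t] good[OF t(1)] unfolding coded_choices_def by (cases "f (k div 2)") auto
      then show thesis
        using that[of "e (t @ [a])" "Suc k"] grown.step[OF t(1)] t(2) False extends[of "t @ [a]"]
        by (metis even_Suc prefixI prefix_order.trans)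
    qed
    have "?A t' k' = succs P t'"
      using t'(3) by (simp add: coded_choices_def)
    then have "succs P t' \<subseteq> succs (Q f) t'"
      using choices_subset_succs[OF t'(1)] by (simp add: Q_def)
    then have "splitting (Q f) t'"
      using good[OF t'(1)] unfolding splitting_def by blast
    moreover have "t' \<in> Q f"
      using t'(1) unfolding Q_def grown_tree_def by blast
    ultimately show ?thesis using t'(2) by blast
  qed
  then have "Q f \<in> sacks_trees" for f
    unfolding sacks_trees_def using is_tree_grown_tree Q_def by auto
  then show "\<exists>Q :: (nat \<Rightarrow> bool) \<Rightarrow> nat list set. (\<forall>f. Q f \<in> sacks_trees \<and> Q f \<subseteq> P) \<and>
      (\<forall>f g. f \<noteq> g \<longrightarrow> body (Q f) \<inter> body (Q g) = {})"
    using sub coded_bodies_disjoint by (intro exI[of _ Q]) (simp add: Q_def)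
qed

text \<open>
  The infinitely many successors of a node are divided into two infinite classes, so grown nodes
  of every level keep infinitely many successors.
\<close>

lemma miller_splits_disjointly: "splits_disjointly miller_trees"
  unfolding splits_disjointly_def
proof
  fix P assume "P \<in> miller_trees"
  then have P: "is_tree P" and ext: "\<forall>s\<in>P. \<exists>t\<in>P. prefix s t \<and> infinite (succs P t)"
    unfolding miller_trees_def by auto
  obtain e where "node_extension e" and e: "\<And>s. s \<in> P \<Longrightarrow> e s \<in> P \<and> infinite (succs P (e s))"
    using good_extension[OF P ext] by blast
  interpret node_extension e by fact
  obtain C where C: "\<And>t. infinite (succs P t) \<Longrightarrow> infinite (succs P t \<inter> C t) \<and> infinite (succs P t - C t)"
    using infinite_halving by blast
  define Q where "Q f = grown_tree e (coded_choices P C f)" for f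
  have good: "t \<in> P \<and> infinite (succs P t)" if "grown e (coded_choices P C f) t k" for f t k
    using grown_coded_good[of e "{t \<in> P. infinite (succs P t)}" P C f t k] that e is_tree_Nil[OF P]
    by (auto simp: succs_def)
  have sub: "Q f \<subseteq> P" for f
    unfolding Q_def using grown_tree_subset[OF P] good by blast
  have "\<exists>t\<in>Q f. prefix s t \<and> infinite (succs (Q f) t)" if s: "s \<in> Q f" for s f
  proof -
    obtain t k where t: "grown e (coded_choices P C f) t k" "prefix s t"
      using s unfolding Q_def grown_tree_def by blast
    have "infinite (succs (Q f) t)"
      using infinite_coded_choices[of P t C f k] C[of t] good[OF t(1)] choices_subset_succs[OF t(1)]
        finite_subset unfolding Q_def by blast
    moreover have "t \<in> Q f"
      using t(1) unfolding Q_def grown_tree_def by blast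
    ultimately show ?thesis using t(2) by blast
  qed
  then have "Q f \<in> miller_trees" for f
    unfolding miller_trees_def using is_tree_grown_tree Q_def by auto
  then show "\<exists>Q :: (nat \<Rightarrow> bool) \<Rightarrow> nat list set. (\<forall>f. Q f \<in> miller_trees \<and> Q f \<subseteq> P) \<and>
      (\<forall>f g. f \<noteq> g \<longrightarrow> body (Q f) \<inter> body (Q g) = {})"
    using sub coded_bodies_disjoint by (intro exI[of _ Q]) (simp add: Q_def)
qed

text \<open>
  Above the stem every node already has infinitely many successors. The first grown node is
  the stem, and from there on the tree grows one entry at a time. All nodes of the new tree
  above the stem are then grown nodes, and the stem is preserved. The latter
  also settles complete Laver trees, whose stem is the root.
\<close>

lemma laver_tree_splits_above_stem:
  assumes P: "is_tree P" and stem: "is_stem P \<tau>" and inf: "\<forall>t\<in>P. prefix \<tau> t \<longrightarrow> infinite (succs P t)"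
  obtains Q :: "(nat \<Rightarrow> bool) \<Rightarrow> nat list set" where
    "\<And>f. Q f \<in> laver_trees" "\<And>f. is_stem (Q f) \<tau>" "\<And>f. Q f \<subseteq> P"
    "\<And>f g. f \<noteq> g \<Longrightarrow> body (Q f) \<inter> body (Q g) = {}"
proof -
  define e where "e s = (if prefix s \<tau> then \<tau> else s)" for s
  interpret node_extension e by unfold_locales (auto simp: e_def)
  have e_above: "e (t @ [a]) = t @ [a]" if "prefix \<tau> t" for t a
  proof -
    have "\<not> prefix (t @ [a]) \<tau>"
      using prefix_length_le[OF that] prefix_length_le[of "t @ [a]" \<tau>] by auto
    then show ?thesis by (simp add: e_def)
  qed
  have e_Nil: "e [] = \<tau>"
    by (simp add: e_def)
  obtain C where C: "\<And>t. infinite (succs P t) \<Longrightarrow> infinite (succs P t \<inter> C t) \<and> infinite (succs P t - C t)"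
    using infinite_halving by blast
  define Q where "Q f = grown_tree e (coded_choices P C f)" for f
  have good: "t \<in> P \<and> prefix \<tau> t" if "grown e (coded_choices P C f) t k" for f t k
    using grown_coded_good[of e "{t \<in> P. prefix \<tau> t}" P C f t k] that stem e_above
    unfolding is_stem_def by (auto simp: e_def succs_def)
  have sub: "Q f \<subseteq> P" for f
    unfolding Q_def using grown_tree_subset[OF P] good by blast
  have above: "\<exists>k. grown e (coded_choices P C f) t k" if t: "t \<in> Q f" "prefix \<tau> t" for t f
  proof -
    obtain u k where "grown e (coded_choices P C f) u k" "prefix t u"
      using t(1) unfolding Q_def grown_tree_def by blast
    then show ?thesis
    proof (induction rule: grown.induct)
      case root
      then have "t = \<tau>" using t(2) by (auto simp: e_Nil)
      then show ?case using grown.root[of e "coded_choices P C f"] by (auto simp: e_Nil)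
    next
      case (step v k a)
      have "e (v @ [a]) = v @ [a]"
        using good[OF step.hyps(1)] e_above by blast
      then show ?case
        using step grown.step[OF step.hyps] by (metis prefix_snoc)
    qed
  qed
  have infQ: "infinite (succs (Q f) t)" if t: "t \<in> Q f" "prefix \<tau> t" for t f
  proof -
    obtain k where k: "grown e (coded_choices P C f) t k" using above[OF t] by blast
    show ?thesis
      using infinite_coded_choices[of P t C f k] C[of t] inf good[OF k] choices_subset_succs[OF k]
        finite_subset unfolding Q_def by blast
  qed
  have \<tau>Q: "\<tau> \<in> Q f" for f
    unfolding Q_def grown_tree_def using grown.root[of e "coded_choices P C f"] by (auto simp: e_Nil)
  have stemQ: "is_stem (Q f) \<tau>" for f
    unfolding is_stem_def
  proof (intro conjI allI impI)
    have inf: "infinite (succs (Q f) \<tau>)" using infQ \<tau>Q by blast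
    then obtain a where a: "a \<in> succs (Q f) \<tau>"
      using infinite_imp_nonempty by (metis ex_in_conv)
    obtain b where "b \<in> succs (Q f) \<tau> - {a}"
      using infinite_remove[OF inf, of a] infinite_imp_nonempty by (metis ex_in_conv)
    with a show "splitting (Q f) \<tau>"
      unfolding splitting_def by blast
  next
    fix s assume s: "strict_prefix s \<tau>"
    then obtain b zs where "\<tau> = s @ b # zs"
      by (auto elim: strict_prefixE')
    then have "prefix (s @ [b]) \<tau>"
      by simp
    then have "s @ [b] \<in> Q f"
      using \<tau>Q is_tree_grown_tree unfolding Q_def is_tree_def by blast
    then have "b \<in> succs (Q f) s" by (simp add: succs_def)
    moreover have "succs (Q f) s \<subseteq> succs P s"
      using sub by (auto simp: succs_def)
    moreover obtain c where "succs P s = {c}"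
      using stem s unfolding is_stem_def by (meson is_singletonE)
    ultimately have "succs (Q f) s = {c}"
      by auto
    then show "is_singleton (succs (Q f) s)"
      by simp
  qed (rule \<tau>Q)
  have "is_tree (Q f)" for f
    unfolding Q_def by (rule is_tree_grown_tree)
  then have "Q f \<in> laver_trees" for f
    unfolding laver_trees_def using stemQ infQ by blast
  then show thesis
    by (rule that[of Q]) (use stemQ sub coded_bodies_disjoint in \<open>simp_all add: Q_def\<close>)
qed

lemma laver_splits_disjointly: "splits_disjointly laver_trees"
  unfolding splits_disjointly_def
proof
  fix P assume "P \<in> laver_trees"
  then obtain \<tau> where "is_tree P" "is_stem P \<tau>" "\<forall>t\<in>P. prefix \<tau> t \<longrightarrow> infinite (succs P t)"
    unfolding laver_trees_def by blast
  then show "\<exists>Q :: (nat \<Rightarrow> bool) \<Rightarrow> nat list set. (\<forall>f. Q f \<in> laver_trees \<and> Q f \<subseteq> P) \<and>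
      (\<forall>f g. f \<noteq> g \<longrightarrow> body (Q f) \<inter> body (Q g) = {})"
    using laver_tree_splits_above_stem by metis
qed

lemma complete_laver_splits_disjointly: "splits_disjointly complete_laver_trees"
  unfolding splits_disjointly_def
proof
  fix P assume "P \<in> complete_laver_trees"
  then obtain \<tau> where P: "is_tree P" "is_stem P \<tau>" "\<forall>t\<in>P. prefix \<tau> t \<longrightarrow> infinite (succs P t)"
    and stem: "is_stem P []"
    unfolding complete_laver_trees_def laver_trees_def by blast
  have "\<not> is_singleton (succs P [])"
    using stem unfolding is_stem_def splitting_def is_singleton_def by fastforce
  then have "\<tau> = []"
    using P(2) unfolding is_stem_def by (metis prefix_order.less_le Nil_prefix)
  then obtain Q :: "(nat \<Rightarrow> bool) \<Rightarrow> nat list set" where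
    "\<And>f. Q f \<in> laver_trees" "\<And>f. is_stem (Q f) []" "\<And>f. Q f \<subseteq> P"
    "\<And>f g. f \<noteq> g \<Longrightarrow> body (Q f) \<inter> body (Q g) = {}"
    using laver_tree_splits_above_stem[OF P] by metis
  then show "\<exists>Q :: (nat \<Rightarrow> bool) \<Rightarrow> nat list set. (\<forall>f. Q f \<in> complete_laver_trees \<and> Q f \<subseteq> P) \<and>
      (\<forall>f g. f \<noteq> g \<longrightarrow> body (Q f) \<inter> body (Q g) = {})"
    unfolding complete_laver_trees_def by blast
qed

section \<open>Closed null sets and comeager sets\<close>

lemma closed_null_imp_meager:
  fixes E :: "real set"
  assumes "closed E" "negligible E"
  shows "meager E"
proof -
  have "interior E = {}"
    by (metis assms(2) interior_subset negligible_subset open_interior open_not_negligible)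
  then show ?thesis
    unfolding meager_def nowhere_dense_def using assms(1)
    by (intro exI[of _ "{E}"]) (auto simp: closure_closed)
qed

text \<open>
  A compact null set lies in an open set of small measure and has positive distance to
  the complement of that open set.
\<close>

lemma compact_null_thickening:
  fixes K :: "real set"
  assumes "compact K" "negligible K" "e > 0"
  obtains d U where "d > 0" "U \<in> lmeasurable" "measure lebesgue U \<le> e" "(\<Union>z\<in>K. ball z d) \<subseteq> U"
proof -
  have "K \<in> sets lebesgue"
    using assms(2) by (simp add: negligible_imp_sets)
  then obtain U where U: "open U" "K \<subseteq> U" "U - K \<in> lmeasurable" "emeasure lebesgue (U - K) < ennreal e"
    using sets_lebesgue_outer_open assms(3) by blast
  obtain d where d: "d > 0" "(\<Union>z\<in>K. ball z d) \<subseteq> U"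
    using compact_subset_open_imp_ball_epsilon_subset assms(1) U(1,2) by metis
  have "K \<in> null_sets lebesgue"
    using assms(2) by (simp add: negligible_iff_null_sets)
  then have m: "measure lebesgue U = measure lebesgue (U - K)"
    using U(1) by (simp add: measure_Diff_null_set)
  have "U = (U - K) \<union> K"
    using U(2) by auto
  then have "U \<in> lmeasurable"
    by (metis U(3) assms(2) fmeasurable.Un negligible_imp_measurable)
  moreover have "measure lebesgue U \<le> e"
    using U(3,4) assms(3) unfolding m
    by (simp add: emeasure_eq_measure2 ennreal_less_iff)
  ultimately show thesis
    using that d by blast
qed

text \<open>
  The complement of \<open>M\<close> is a dense \<open>G\<^sub>\<delta>\<close> set, the intersection of sets \<open>W k\<close> that are unions of tiny balls around
  all rationals. For a compact null set \<open>K\<close>, the set of differences between \<open>K\<close> and a ball of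
  radius \<open>d\<close> is a translate of the \<open>d\<close>-neighbourhood of \<open>K\<close>, because balls are symmetric
  about their centre, and so has small measure for small \<open>d\<close>.
  Summing over the rationals, differences between \<open>K\<close> and \<open>W k\<close> have measure at most \<open>2 / 2 ^ k\<close>,
  and the differences between \<open>K\<close> and the intersection form a null set. A closed null set
  is the union of its compact parts \<open>E \<inter> cball 0 i\<close>. One sequence of radii serves them all, because
  the radius \<open>d n\<close> is chosen for the part with index \<open>n\<close>, hence for all smaller indices.
\<close>

lemma closed_null_minus_comeager_null:
  fixes E :: "real set"
  assumes "closed E" "negligible E"
  obtains M where "meager M" "negligible {z - x | z x. z \<in> E \<and> x \<notin> M}"
proof -
  have "\<exists>d U. d > 0 \<and> U \<in> lmeasurable \<and> measure lebesgue U \<le> (1/2)^n \<and>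
          (\<Union>z\<in>E \<inter> cball 0 (real n). ball z d) \<subseteq> U" for n
  proof -
    have "compact (E \<inter> cball 0 (real n))" "negligible (E \<inter> cball 0 (real n))"
      using assms by (auto intro: negligible_subset)
    then show ?thesis
      using compact_null_thickening[of "E \<inter> cball 0 (real n)" "(1/2)^n"] by (metis zero_less_power half_gt_zero zero_less_one)
  qed
  then obtain d U where d: "\<And>n. d n > (0::real)"
    and U: "\<And>n. U n \<in> lmeasurable" "\<And>n. measure lebesgue (U n) \<le> (1/2)^n"
      "\<And>n. (\<Union>z\<in>E \<inter> cball 0 (real n). ball z (d n)) \<subseteq> U n"
    by metis
  define q where "q = from_nat_into (\<rat> :: real set)"
  define W where "W k = (\<Union>j. ball (q j) (d (j + k)))" for k
  have "nowhere_dense (- W k)" for k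
  proof -
    have "\<rat> = range q"
      unfolding q_def by (metis Rats_0 countable_rat empty_iff range_from_nat_into)
    moreover have "range q \<subseteq> W k"
    proof (rule image_subsetI)
      fix j
      have "q j \<in> ball (q j) (d (j + k))"
        using d by simp
      then show "q j \<in> W k"
        unfolding W_def by blast
    qed
    ultimately have "\<rat> \<subseteq> W k"
      by simp
    then have "closure (W k) = UNIV"
      by (metis Rats_closure_real closure_mono top.extremum_uniqueI)
    moreover have "closed (- W k)"
      unfolding W_def by (auto simp: closed_Compl)
    ultimately show ?thesis
      unfolding nowhere_dense_def by (simp add: interior_closure)
  qed
  then have M: "meager (\<Union>k. - W k)"
    unfolding meager_def by (intro exI[of _ "range (\<lambda>k. - W k)"]) auto
  have "negligible {z - x | z x. z \<in> E \<inter> cball 0 (real i) \<and> x \<notin> (\<Union>k. - W k)}" (is "negligible ?D") for i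
    unfolding negligible_outer_le
  proof (intro allI impI)
    fix e :: real assume "e > 0"
    then obtain k0 where k0: "(1/2)^k0 < e/2"
      using real_arch_pow_inv[of "e/2" "1/2"] by auto
    \<comment> \<open>All radii used in \<open>W k\<close> have index at least \<open>k \<ge> i\<close>, so they suit the part \<open>E \<inter> cball 0 i\<close>.\<close>
    define k where "k = max i k0"
    have "(1/2::real)^k \<le> (1/2)^k0"
      unfolding k_def by (rule power_decreasing) auto
    with k0 have ke: "(1/2)^k < e/2" by linarith
    define V where "V j = (\<lambda>u. u - q j) ` U (j + k)" for j
    have V: "V j \<in> lmeasurable" "measure lebesgue (V j) \<le> (1/2)^(j+k)" for j
      unfolding V_def using U by (auto simp: measurable_translation_subtract measure_translation_subtract)
    have bound: "measure lebesgue (\<Union>j\<in>J. V j) \<le> e" if "finite J" for J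
    proof -
      have "measure lebesgue (\<Union>j\<in>J. V j) \<le> (\<Sum>j\<in>J. measure lebesgue (V j))"
        using V that by (intro measure_UNION_le) auto
      also have "\<dots> \<le> (\<Sum>j\<in>J. (1/2)^(j+k))"
        using V by (intro sum_mono) auto
      also have "\<dots> = (\<Sum>j\<in>J. (1/2)^j) * (1/2)^k"
        by (simp add: power_add sum_distrib_right)
      also have "\<dots> \<le> (\<Sum>j. (1/2)^j) * (1/2::real)^k"
        using that by (intro mult_right_mono sum_le_suminf summable_geometric) auto
      also have "\<dots> = 2 * (1/2)^k"
        by (simp add: suminf_geometric)
      finally show ?thesis using ke by simp
    qed
    have "?D \<subseteq> (\<Union>j. V j)"
    proof
      fix y assume "y \<in> ?D"
      then obtain z x where y: "y = z - x" and z: "z \<in> E" "\<bar>z\<bar> \<le> real i" and "x \<in> W k"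
        by auto
      then obtain j where j: "\<bar>q j - x\<bar> < d (j + k)"
        unfolding W_def by (auto simp: dist_real_def)
      have "z \<in> E \<inter> cball 0 (real (j + k))"
        using z by (auto simp: k_def)
      moreover have "y + q j \<in> ball z (d (j + k))"
        using j y by (auto simp: dist_real_def)
      ultimately have "y + q j \<in> U (j + k)"
        using U(3) by blast
      then have "y \<in> V j"
        unfolding V_def by (metis add_diff_cancel_right' imageI)
      then show "y \<in> (\<Union>j. V j)" by blast
    qed
    moreover have "(\<Union>j. V j) \<in> lmeasurable" "measure lebesgue (\<Union>j. V j) \<le> e"
      using fmeasurable_UN_bound[of UNIV V lebesgue e] measure_UN_bound[of UNIV V lebesgue e] V bound by auto
    ultimately show "\<exists>T. ?D \<subseteq> T \<and> T \<in> lmeasurable \<and> measure lebesgue T \<le> e"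
      by blast
  qed
  then have "negligible (\<Union>i. {z - x | z x. z \<in> E \<inter> cball 0 (real i) \<and> x \<notin> (\<Union>k. - W k)})"
    by (intro negligible_countable_Union) auto
  moreover have "{z - x | z x. z \<in> E \<and> x \<notin> (\<Union>k. - W k)} \<subseteq>
      (\<Union>i. {z - x | z x. z \<in> E \<inter> cball 0 (real i) \<and> x \<notin> (\<Union>k. - W k)})"
  proof
    fix y assume "y \<in> {z - x | z x. z \<in> E \<and> x \<notin> (\<Union>k. - W k)}"
    then obtain z x where "y = z - x" "z \<in> E" "x \<notin> (\<Union>k. - W k)" by auto
    moreover obtain i where "\<bar>z\<bar> \<le> real i"
      using real_arch_simple by blast
    ultimately show "y \<in> (\<Union>i. {z - x | z x. z \<in> E \<inter> cball 0 (real i) \<and> x \<notin> (\<Union>k. - W k)})"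
      by auto
  qed
  ultimately show thesis
    using M that negligible_subset by blast
qed

text \<open>
  Inside a bounded ball the measures of finitely many members add up to at most the measure of the ball.
  The family of these measures is therefore summable, and only countably many are nonzero. The
  balls with integer radius give countably many exceptional members altogether.
\<close>

lemma uncountable_disjoint_family_has_null:
  fixes E :: "'i \<Rightarrow> real set"
  assumes meas: "\<And>i. i \<in> I \<Longrightarrow> E i \<in> sets lebesgue" and disj: "disjoint_family_on E I" and "uncountable I"
  obtains i where "i \<in> I" "negligible (E i)"
proof -
  define f where "f n i = measure lebesgue (E i \<inter> cball 0 (real n))" for n i
  have fin: "E i \<inter> cball 0 (real n) \<in> lmeasurable" if "i \<in> I" for n i
    using meas[OF that] by (metis Int_commute fmeasurable_Int_fmeasurable lmeasurable_cball)
  have "f n summable_on I" for n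
  proof (rule nonneg_bdd_above_summable_on)
    show "bdd_above (sum (f n) ` {F. F \<subseteq> I \<and> finite F})"
    proof (rule bdd_aboveI2)
      fix F assume "F \<in> {F. F \<subseteq> I \<and> finite F}"
      then have F: "F \<subseteq> I" "finite F" by auto
      have "pairwise (\<lambda>i j. disjnt (E i \<inter> cball 0 (real n)) (E j \<inter> cball 0 (real n))) F"
        using disj F(1) unfolding disjoint_family_on_def pairwise_def disjnt_def by blast
      then have "sum (f n) F = measure lebesgue (\<Union>i\<in>F. E i \<inter> cball 0 (real n))"
        unfolding f_def using F fin by (intro measure_UNION'[symmetric]) auto
      also have "\<dots> \<le> measure lebesgue (cball 0 (real n) :: real set)"
        using F fin by (intro measure_mono_fmeasurable sets.finite_UN) auto
      finally show "sum (f n) F \<le> measure lebesgue (cball 0 (real n) :: real set)" .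
    qed
  qed (simp add: f_def)
  then have "countable (\<Union>n. {i \<in> I. f n i \<noteq> 0})"
    by (intro countable_UN) (auto intro: summable_countable_real)
  then have "\<not> I \<subseteq> (\<Union>n. {i \<in> I. f n i \<noteq> 0})"
    using \<open>uncountable I\<close> countable_subset by blast
  then obtain i where i: "i \<in> I" "\<And>n. f n i = 0"
    by blast
  have "negligible (E i \<inter> cball 0 (real n))" for n
    using fin[OF i(1)] i(2)[of n] by (simp add: f_def negligible_iff_measure)
  then have "negligible (\<Union>n. E i \<inter> cball 0 (real n))"
    by (intro negligible_countable_Union) auto
  moreover have "(\<Union>n. E i \<inter> cball 0 (real n)) = E i"
    by (auto simp: real_arch_simple)
  ultimately show thesis
    using that i(1) by simp
qed

section \<open>Sets of size less than the continuum\<close>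

text \<open>
  This links \<open>\<prec>\<close> to the cardinal order on which regularity is defined.
\<close>

lemma lesspoll_iff_card_less:
  includes cardinal_syntax
  shows "A \<prec> B \<longleftrightarrow> |A| <o |B|"
proof -
  have 1: "A \<lesssim> B \<longleftrightarrow> |A| \<le>o |B|" and 2: "B \<lesssim> A \<longleftrightarrow> |B| \<le>o |A|"
    unfolding lepoll_def by (rule card_of_ordLeq)+
  have "A \<prec> B \<longleftrightarrow> \<not> B \<lesssim> A"
  proof
    show "A \<prec> B \<Longrightarrow> \<not> B \<lesssim> A"
      unfolding lesspoll_def using lepoll_antisym[of A B] by blast
    assume "\<not> B \<lesssim> A"
    moreover from this have "A \<lesssim> B"
      unfolding 1 2 using ordLeq_total[OF card_of_Well_order card_of_Well_order, of A B] by blast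
    ultimately show "A \<prec> B"
      unfolding lesspoll_def by (meson eqpoll_imp_lepoll eqpoll_sym)
  qed
  also have "\<dots> \<longleftrightarrow> |A| <o |B|"
    unfolding 2 by (rule not_ordLeq_iff_ordLess) (rule card_of_Well_order)+
  finally show ?thesis .
qed

lemma small_UNION:
  fixes I :: "'i set" and F :: "'i \<Rightarrow> 'a set"
  assumes reg: "regularCard (BNF_Cardinal_Arithmetic.cexp BNF_Cardinal_Arithmetic.ctwo natLeq)"
    and "I \<prec> (UNIV :: (nat \<Rightarrow> bool) set)" and "\<And>i. i \<in> I \<Longrightarrow> F i \<prec> (UNIV :: (nat \<Rightarrow> bool) set)"
  shows "(\<Union>i\<in>I. F i) \<prec> (UNIV :: (nat \<Rightarrow> bool) set)"
proof -
  include cardinal_syntax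
  have "BNF_Cardinal_Arithmetic.cexp BNF_Cardinal_Arithmetic.ctwo natLeq = |UNIV :: (nat \<Rightarrow> bool) set|"
    unfolding BNF_Cardinal_Arithmetic.cexp_def BNF_Cardinal_Arithmetic.ctwo_def Field_natLeq
    by (simp add: Field_card_of Func_def)
  then have "stable |UNIV :: (nat \<Rightarrow> bool) set|"
    using reg by (intro regularCard_stable card_of_Card_order)
      (simp_all add: Field_card_of finite_UNIV_fun)
  then show ?thesis
    using assms(2,3) unfolding lesspoll_iff_card_less by (rule stable_UNION)
qed

lemma reals_lepoll_bool_sequences: "X \<lesssim> (UNIV :: (nat \<Rightarrow> bool) set)" for X :: "real set"
proof -
  have "X \<lesssim> (UNIV :: real set)"
    by (simp add: subset_imp_lepoll)
  also have "\<dots> \<lesssim> (UNIV :: nat set set)"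
    using nat_sets_eqpoll_reals eqpoll_sym eqpoll_imp_lepoll by blast
  also have "\<dots> \<lesssim> (UNIV :: (nat \<Rightarrow> bool) set)"
    unfolding lepoll_def by (rule exI[of _ "\<lambda>A n. n \<in> A"]) (auto simp: inj_on_def fun_eq_iff)
  finally show ?thesis .
qed

section \<open>Sums of generalized Luzin and Sierpinski sets\<close>

text \<open>
  A point \<open>x + y\<close> of \<open>E\<close> with \<open>x \<notin> M\<close> has \<open>y \<in> N\<close>. So either \<open>x\<close> or \<open>y\<close> is confined to a
  small set, and for each value of the confined summand the other one has few values.
\<close>

lemma sum_meets_closed_null_in_small:
  assumes reg: "regularCard (BNF_Cardinal_Arithmetic.cexp BNF_Cardinal_Arithmetic.ctwo natLeq)"
    and L: "generalized_Luzin L" and S: "generalized_Sierpinski S"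
    and E: "closed E" "negligible E"
  shows "{x + y | x y. x \<in> L \<and> y \<in> S} \<inter> E \<prec> (UNIV :: (nat \<Rightarrow> bool) set)"
proof -
  obtain M where M: "meager M" and N: "negligible {z - x | z x. z \<in> E \<and> x \<notin> M}"
    using closed_null_minus_comeager_null[OF E] by blast
  define N where "N = {z - x | z x. z \<in> E \<and> x \<notin> M}"
  have meager_small: "A \<inter> L \<prec> (UNIV :: (nat \<Rightarrow> bool) set)" if "meager A" for A
    using L that reals_lepoll_bool_sequences unfolding generalized_Luzin_def
    by (metis lesspoll_trans2)
  have null_small: "A \<inter> S \<prec> (UNIV :: (nat \<Rightarrow> bool) set)" if "negligible A" for A
    using S that reals_lepoll_bool_sequences unfolding generalized_Sierpinski_def negligible_iff_null_sets
    by (metis lesspoll_trans2)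
  have shift: "closed ((+) (- x) ` E)" "negligible ((+) (- x) ` E)" for x
    by (rule closed_translation[OF E(1)], rule negligible_translation[OF E(2)])
  have S_fiber: "(+) x ` ((+) (- x) ` E \<inter> S) \<prec> (UNIV :: (nat \<Rightarrow> bool) set)" for x
    using null_small[OF shift(2)] image_lepoll lesspoll_trans1 by blast
  have L_fiber: "(+) y ` ((+) (- y) ` E \<inter> L) \<prec> (UNIV :: (nat \<Rightarrow> bool) set)" for y
    using meager_small[OF closed_null_imp_meager[OF shift]] image_lepoll lesspoll_trans1 by blast
  have parts: "(\<Union>x\<in>M \<inter> L. (+) x ` ((+) (- x) ` E \<inter> S)) \<prec> (UNIV :: (nat \<Rightarrow> bool) set)"
    "(\<Union>y\<in>N \<inter> S. (+) y ` ((+) (- y) ` E \<inter> L)) \<prec> (UNIV :: (nat \<Rightarrow> bool) set)"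
    by (rule small_UNION[OF reg meager_small[OF M] S_fiber],
        rule small_UNION[OF reg null_small[OF N[folded N_def]] L_fiber])
  \<comment> \<open>The union of the two parts is treated as a family indexed by \<open>bool\<close>, so that regularity applies to it too.\<close>
  define U where "U b = (if b then \<Union>x\<in>M \<inter> L. (+) x ` ((+) (- x) ` E \<inter> S)
    else \<Union>y\<in>N \<inter> S. (+) y ` ((+) (- y) ` E \<inter> L))" for b
  have "(UNIV :: bool set) \<prec> (UNIV :: (nat \<Rightarrow> bool) set)"
    by (rule finite_lesspoll_infinite) (simp_all add: finite_UNIV_fun)
  then have "(\<Union>b\<in>UNIV. U b) \<prec> (UNIV :: (nat \<Rightarrow> bool) set)"
    using parts by (intro small_UNION[OF reg]) (auto simp: U_def)
  moreover have "{x + y | x y. x \<in> L \<and> y \<in> S} \<inter> E \<subseteq> (\<Union>b\<in>UNIV. U b)"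
  proof
    fix z assume "z \<in> {x + y | x y. x \<in> L \<and> y \<in> S} \<inter> E"
    then obtain x y where xy: "x \<in> L" "y \<in> S" "z = x + y" "z \<in> E" by blast
    then have shifted: "y \<in> (+) (- x) ` E" "x \<in> (+) (- y) ` E"
      by (auto intro!: image_eqI[of _ _ z])
    show "z \<in> (\<Union>b\<in>UNIV. U b)"
    proof (cases "x \<in> M")
      case True
      then have "z \<in> U True" unfolding U_def using xy shifted by auto
      then show ?thesis by blast
    next
      case False
      then have "y \<in> N" unfolding N_def using xy by force
      moreover have "z \<in> (+) y ` ((+) (- y) ` E \<inter> L)"
        using xy shifted by (intro image_eqI[of _ _ x]) auto
      ultimately have "z \<in> U False"
        unfolding U_def using xy(2) by auto
      then show ?thesis by blast
    qed
  qed
  ultimately show ?thesis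
    using subset_imp_lepoll lesspoll_trans1 by blast
qed

lemma closed_image_irrational_coding:
  assumes "irrational_coding h" "closed C"
  shows "h ` C = closure (h ` C) - \<rat>"
proof -
  have "closed_map euclidean (top_of_set (- \<rat>)) h"
    using assms(1) homeomorphic_imp_closed_map unfolding irrational_coding_def by blast
  then have "closedin (top_of_set (- \<rat>)) (h ` C)"
    using assms(2) unfolding closed_map_def by simp
  then obtain F where F: "closed F" "h ` C = - \<rat> \<inter> F"
    by (auto simp: closedin_closed)
  then have "closure (h ` C) \<subseteq> F"
    by (intro closure_minimal) auto
  then show ?thesis
    using F(2) closure_subset[of "h ` C"] by blast
qed

lemma tree_ideal_contains_sum:
  assumes reg: "regularCard (BNF_Cardinal_Arithmetic.cexp BNF_Cardinal_Arithmetic.ctwo natLeq)"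
    and h: "irrational_coding h" and split: "splits_disjointly \<T>"
    and L: "generalized_Luzin L" and S: "generalized_Sierpinski S"
  shows "h -` {x + y | x y. x \<in> L \<and> y \<in> S} \<in> tree_ideal \<T>"
  unfolding tree_ideal_def
proof (intro CollectI ballI)
  fix P assume "P \<in> \<T>"
  define Z where "Z = {x + y | x y. x \<in> L \<and> y \<in> S}"
  have inj: "inj h"
    using h unfolding irrational_coding_def homeomorphic_map_def by simp
  have rat: "negligible (\<rat> :: real set)"
    using countable_rat by (rule countable_imp_null_set_lborel[THEN null_sets_completionI, folded negligible_iff_null_sets])
  have image: "h ` body T = closure (h ` body T) - \<rat>" for T
    using closed_image_irrational_coding[OF h closed_body] .
  obtain R :: "(nat \<Rightarrow> bool) \<Rightarrow> nat list set" where R: "\<And>f. R f \<in> \<T>" "\<And>f. R f \<subseteq> P"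
    and R_disj: "\<And>f g. f \<noteq> g \<Longrightarrow> body (R f) \<inter> body (R g) = {}"
    using split \<open>P \<in> \<T>\<close> unfolding splits_disjointly_def by metis
  have meas: "h ` body (R f) \<in> sets lebesgue" for f
  proof -
    have "closure (h ` body (R f)) \<in> sets lebesgue"
      by (intro sets_completionI_sets) simp
    then show ?thesis
      by (subst image) (rule sets.Diff[OF _ negligible_imp_sets[OF rat]])
  qed
  have disj: "disjoint_family_on (\<lambda>f. h ` body (R f)) UNIV"
    unfolding disjoint_family_on_def using R_disj by (simp flip: image_Int[OF inj])
  have unc: "uncountable (UNIV :: (nat \<Rightarrow> bool) set)"
    using uncountable_UNIV_real reals_lepoll_bool_sequences[of UNIV] countable_lepoll by blast
  obtain f where null: "negligible (h ` body (R f))"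
    by (rule uncountable_disjoint_family_has_null[OF meas disj unc])
  define E where "E = closure (h ` body (R f))"
  have "E \<subseteq> h ` body (R f) \<union> \<rat>"
    using image[of "R f"] unfolding E_def by blast
  then have "negligible E"
    using negligible_subset[OF negligible_Un[OF null rat]] by blast
  then have small: "Z \<inter> E \<prec> (UNIV :: (nat \<Rightarrow> bool) set)"
    using sum_meets_closed_null_in_small[OF reg L S] unfolding Z_def by (simp add: E_def)
  obtain Q :: "(nat \<Rightarrow> bool) \<Rightarrow> nat list set" where Q: "\<And>g. Q g \<in> \<T>" "\<And>g. Q g \<subseteq> R f"
    and Q_disj: "\<And>g g'. g \<noteq> g' \<Longrightarrow> body (Q g) \<inter> body (Q g') = {}"
    using split R(1)[of f] unfolding splits_disjointly_def by metis
  have "\<exists>g. body (Q g) \<inter> h -` Z = {}"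
  proof (rule ccontr)
    assume "\<not> ?thesis"
    then have "\<forall>g. \<exists>x. x \<in> body (Q g) \<and> h x \<in> Z" by blast
    then obtain p where p: "\<And>g. p g \<in> body (Q g)" "\<And>g. h (p g) \<in> Z" by metis
    have "inj (\<lambda>g. h (p g))"
    proof (rule injI)
      fix g g' assume "h (p g) = h (p g')"
      then have "p g = p g'" using inj by (simp add: inj_eq)
      then show "g = g'" using Q_disj[of g g'] p(1)[of g] p(1)[of g'] by auto
    qed
    moreover have "h (p g) \<in> Z \<inter> E" for g
      using p body_mono[OF Q(2)] closure_subset unfolding E_def by blast
    ultimately have "(UNIV :: (nat \<Rightarrow> bool) set) \<lesssim> Z \<inter> E"
      unfolding lepoll_def by blast
    then show False
      using small lepoll_antisym unfolding lesspoll_def by blast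
  qed
  then obtain g where "body (Q g) \<inter> h -` Z = {}"
    by blast
  moreover have "Q g \<subseteq> P"
    using Q(2)[of g] R(2)[of f] by blast
  ultimately show "\<exists>Q\<in>\<T>. Q \<subseteq> P \<and> body Q \<inter> h -` {x + y | x y. x \<in> L \<and> y \<in> S} = {}"
    using Q(1) unfolding Z_def by blast
qed

theorem theorem26:
  fixes h :: "(nat \<Rightarrow> nat) \<Rightarrow> real" and t0 :: "(nat \<Rightarrow> nat) set set" and L S :: "real set"
  assumes "regularCard (BNF_Cardinal_Arithmetic.cexp BNF_Cardinal_Arithmetic.ctwo natLeq)"
    and "irrational_coding h"
    and "t0 \<in> {s0, m0, l0, cl0}"
    and "generalized_Luzin L"
    and "generalized_Sierpinski S"
  shows "in_ideal_via h t0 {x + y | x y. x \<in> L \<and> y \<in> S}"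
proof -
  obtain \<T> where "t0 = tree_ideal \<T>" "splits_disjointly \<T>"
    using assms(3) sacks_splits_disjointly miller_splits_disjointly laver_splits_disjointly
      complete_laver_splits_disjointly unfolding s0_def m0_def l0_def cl0_def by blast
  then show ?thesis
    using tree_ideal_contains_sum[OF assms(1,2) _ assms(4,5)] unfolding in_ideal_via_def by blast
qed

end
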